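(* Let $G$ be a simple graph with $n$ vertices and $k>1$ connected components. If $\Phi=\{\phi_i\}_{i\in[n]}$ is an $L_G(n,n-k)$-frame for $\mathbb{C}^{n-k}$ with frame operator $S_\Phi$, then $\rho^{(r)}_{\Phi,S_\Phi^{-1}\Phi}=1$ for any $r\in[n-1]\setminus\{1\}$.
   Context: $[n]=\{1,\dots,n\}$. A finite sequence $\Phi=\{\phi_i\}_{i\in[n]}$ in $\mathbb{C}^m$ is a frame for $\mathbb{C}^m$ if there are constants $0<A\le B$ with $A\|f\|^2\le\sum_{i\in[n]}|\langle f,\phi_i\rangle|^2\le B\|f\|^2$ for all $f\in\mathbb{C}^m$ (inner product linear in the first argument). Its frame operator is $S_\Phi f=\sum_{i\in[n]}\langle f,\phi_i\rangle\phi_i$, which is invertible. A frame $\Psi=\{\psi_i\}_{i\in[n]}$ for $\mathbb{C}^m$ is a dual frame of $\Phi$ if $f=\sum_{i\in[n]}\langle f,\phi_i\rangle\psi_i=\sum_{i\in[n]}\langle f,\psi_i\rangle\phi_i$ for all $f\in\mathbb{C}^m$; the canonical dual frame is $S_\Phi^{-1}\Phi=\{S_\Phi^{-1}\phi_i\}_{i\in[n]}$. For a frame $\Phi$, a dual frame $\Psi$ of $\Phi$ and $\Lambda\subset[n]$, the error operator is $E_{\Phi,\Psi,\Lambda}:\mathbb{C}^m\to\mathbb{C}^m$, $E_{\Phi,\Psi,\Lambda}(f)=\sum_{i\in\Lambda}\langle f,\phi_i\rangle\psi_i$. For $1\le r<n$, $\rho^{(r)}_{\Phi,\Psi}=\max\{\rho(E_{\Phi,\Psi,\Lambda}):\Lambda\subset[n],\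 |\Lambda|=r\}$, where $\rho(\cdot)$ denotes the spectral radius. For a simple graph $G$ with vertices $v_1,\dots,v_n$, the Laplacian matrix is $L=D-A$, with $D$ the diagonal matrix of vertex degrees and $A$ the adjacency matrix. It is positive semidefinite, and if $G$ has $n-m$ connected components then $L$ has rank $m$. $L_G(n,m)$-frame: let $G$ be a simple graph on $n$ vertices with $n-m$ connected components, and write $L=M\,\mathrm{diag}(\lambda_1,\dots,\lambda_m,0,\dots,0)\,M^*$ with $M$ an $n\times n$ unitary matrix and $\lambda_1,\dots,\lambda_m$ the nonzero eigenvalues of $L$ (with multiplicity). Let $M_1$ be the submatrix of $M$ formed by its first $m$ columns, $B=\mathrm{diag}(\sqrt{\lambda_1},\dots,\sqrt{\lambda_m})M_1^*$, and $\{e_i\}_{i\in[n]}$ the standard basis of $\mathbb{C}^n$. Then $\{Be_i\}_{i\in[n]}$ is a frame for $\mathbb{C}^m$; any frame arising in this way is called an $L_G(n,m)$-frame for $\mathbb{C}^m$. *)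

theory Defs
  imports
    "Graph_Theory.Digraph_Component"
    "Jordan_Normal_Form.Spectral_Radius"
begin

text \<open>
  The space \<open>\<complex>\<^sup>m\<close> is \<^term>\<open>carrier_vec m :: complex vec set\<close>, with the inner product
  \<^term>\<open>x \<bullet>c y\<close>, which is linear in \<^term>\<open>x\<close>. Families indexed by \<open>[n]\<close> are functions on
  \<^typ>\<open>nat\<close> used only on the index set \<^term>\<open>{..<n}\<close> (indices start at 0, as for vectors and
  matrices).
\<close>

section \<open>Frame operator, canonical dual, error operators\<close>

definition frame_op :: "nat \<Rightarrow> nat \<Rightarrow> (nat \<Rightarrow> complex vec) \<Rightarrow> complex vec \<Rightarrow> complex vec" where
  "frame_op n m \<Phi> f = finsum_vec TYPE(complex) m (\<lambda>i. (f \<bullet>c \<Phi> i) \<cdot>\<^sub>v \<Phi> i) {..<n}"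

definition canonical_dual :: "nat \<Rightarrow> nat \<Rightarrow> (nat \<Rightarrow> complex vec) \<Rightarrow> nat \<Rightarrow> complex vec" where
  "canonical_dual n m \<Phi> i = inv_into (carrier_vec m) (frame_op n m \<Phi>) (\<Phi> i)"

definition error_op ::
  "nat \<Rightarrow> (nat \<Rightarrow> complex vec) \<Rightarrow> (nat \<Rightarrow> complex vec) \<Rightarrow> nat set \<Rightarrow> complex vec \<Rightarrow> complex vec" where
  "error_op m \<Phi> \<Psi> \<Lambda> f = finsum_vec TYPE(complex) m (\<lambda>i. (f \<bullet>c \<Phi> i) \<cdot>\<^sub>v \<Psi> i) \<Lambda>"

text \<open>
  \<^const>\<open>spectral_radius\<close> is a notion for matrices; a linear operator on \<open>\<complex>\<^sup>m\<close> is passed to it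
  through its matrix with respect to the standard basis.
\<close>

definition op_mat :: "nat \<Rightarrow> (complex vec \<Rightarrow> complex vec) \<Rightarrow> complex mat" where
  "op_mat m T = mat m m (\<lambda>(i, j). T (unit_vec m j) $ i)"

definition max_error_radius ::
  "nat \<Rightarrow> nat \<Rightarrow> nat \<Rightarrow> (nat \<Rightarrow> complex vec) \<Rightarrow> (nat \<Rightarrow> complex vec) \<Rightarrow> real" where
  "max_error_radius n m r \<Phi> \<Psi> =
     Max {spectral_radius (op_mat m (error_op m \<Phi> \<Psi> \<Lambda>)) | \<Lambda>. \<Lambda> \<subseteq> {..<n} \<and> card \<Lambda> = r}"

section \<open>Laplacian matrix and frames generated by a graph\<close>

text \<open>
  Simple graphs are the finite symmetric digraphs without loops and multiple arcs of the locale
  \<^locale>\<open>graph\<close>: an edge is a pair of opposite arcs, so the degree of a vertex is its out-degree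
  and the connected components are the strongly connected ones. The vertices are labelled
  \<open>v 0, \<dots>, v (n - 1)\<close>.
\<close>

definition laplacian :: "('a, 'b) pre_digraph \<Rightarrow> (nat \<Rightarrow> 'a) \<Rightarrow> nat \<Rightarrow> complex mat" where
  "laplacian G v n =
     mat_diag n (\<lambda>i. of_nat (out_degree G (v i))) -
     mat n n (\<lambda>(i, j). if v i \<rightarrow>\<^bsub>G\<^esub> v j then 1 else 0)"

definition unitary_mat :: "nat \<Rightarrow> complex mat \<Rightarrow> bool" where
  "unitary_mat n M \<longleftrightarrow>
     M \<in> carrier_mat n n \<and> M * mat_adjoint M = 1\<^sub>m n \<and> mat_adjoint M * M = 1\<^sub>m n"

definition LG_mat :: "nat \<Rightarrow> nat \<Rightarrow> complex mat \<Rightarrow> (nat \<Rightarrow> real) \<Rightarrow> complex mat" where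
  "LG_mat n m M l =
     mat_diag m (\<lambda>i. complex_of_real (sqrt (l i))) * mat_adjoint (mat n m (\<lambda>(i, j). M $$ (i, j)))"

text \<open>
  The eigenvalues \<open>l 0, \<dots>, l (m - 1)\<close> are only required to be nonzero; they are positive because
  the Laplacian is positive semidefinite, and by the factorisation they are all the nonzero
  eigenvalues, with multiplicity. That the vectors so obtained form a frame is a consequence and
  hence not part of the definition.
\<close>

definition LG_frame ::
  "('a, 'b) pre_digraph \<Rightarrow> (nat \<Rightarrow> 'a) \<Rightarrow> nat \<Rightarrow> nat \<Rightarrow> (nat \<Rightarrow> complex vec) \<Rightarrow> bool" where
  "LG_frame G v n m \<Phi> \<longleftrightarrow>
     graph G \<and> bij_betw v {..<n} (verts G) \<and>
     m \<le> n \<and> card (pre_digraph.sccs G) = n - m \<and>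
     (\<exists>M l. unitary_mat n M \<and> (\<forall>i<m. l i \<noteq> 0) \<and>
        laplacian G v n =
          M * mat_diag n (\<lambda>i. if i < m then complex_of_real (l i) else 0) * mat_adjoint M \<and>
        (\<forall>i<n. \<Phi> i = LG_mat n m M l *\<^sub>v unit_vec n i))"

end

theory Submission
  imports Defs
begin

text \<open>
  Write the frame as the columns of \<open>diag(s) U\<^sup>*\<close>, where \<open>U\<close> consists of the first \<open>m\<close> columns
  of the unitary matrix \<open>M\<close>. Its frame operator is \<open>diag(s)\<^sup>2\<close>, so the error operator of the
  canonical dual pair is similar, via \<open>diag(s)\<close>, to \<open>U\<^sup>* I\<^sub>\<Lambda> U\<close>, where \<open>I\<^sub>\<Lambda>\<close> is the coordinate
  projection. This is a positive contraction, which bounds the spectral radius by 1, and it fixes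
  \<open>y\<close> as soon as \<open>U y\<close> is supported in \<open>\<Lambda>\<close>. Since the Laplacian is nonzero, \<open>G\<close> has an edge
  \<open>{a, b}\<close>; vectors in the kernel of the Laplacian agree at \<open>a\<close> and \<open>b\<close>, so \<open>e\<^sub>a - e\<^sub>b\<close> lies in
  the column space of \<open>U\<close>, and any \<open>\<Lambda>\<close> of size \<open>r\<close> containing \<open>a\<close> and \<open>b\<close> attains the
  bound.
\<close>

section \<open>Coordinates of unitary matrices and orthonormal families\<close>

lemma index_mat_adjoint:
  assumes "A \<in> carrier_mat n m" "i < m" "j < n"
  shows "mat_adjoint A $$ (i, j) = conjugate (A $$ (j, i))"
  using assms by (auto simp: mat_adjoint_def mat_of_rows_index)

lemma index_mult_mat_sum:
  assumes "A \<in> carrier_mat nr n" "B \<in> carrier_mat n nc" "i < nr" "j < nc"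
  shows "(A * B) $$ (i, j) = (\<Sum>k<n. A $$ (i, k) * B $$ (k, j))"
  using assms by (auto simp: scalar_prod_def lessThan_atLeast0 intro!: sum.cong)

lemma index_mult_mat_vec_sum:
  assumes "A \<in> carrier_mat nr n" "x \<in> carrier_vec n" "i < nr"
  shows "(A *\<^sub>v x) $ i = (\<Sum>k<n. A $$ (i, k) * x $ k)"
  using assms by (auto simp: scalar_prod_def lessThan_atLeast0 intro!: sum.cong)

lemma mat_adjoint_carrier:
  assumes "A \<in> carrier_mat n m"
  shows "mat_adjoint A \<in> carrier_mat m n"
  using assms by (auto simp: mat_adjoint_def)

lemma unitary_mat_cols:
  assumes "unitary_mat n M" "p < n" "q < n"
  shows "(\<Sum>i<n. cnj (M $$ (i, p)) * M $$ (i, q)) = (if p = q then 1 else 0)"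
proof -
  have M: "M \<in> carrier_mat n n" and eq: "mat_adjoint M * M = 1\<^sub>m n"
    using assms(1) by (auto simp: unitary_mat_def)
  have "(mat_adjoint M * M) $$ (p, q) = (\<Sum>i<n. cnj (M $$ (i, p)) * M $$ (i, q))"
    unfolding index_mult_mat_sum[OF mat_adjoint_carrier[OF M] M assms(2,3)]
    by (intro sum.cong refl) (simp add: index_mat_adjoint[OF M assms(2)])
  with eq show ?thesis using assms(2,3) by simp
qed

lemma unitary_mat_rows:
  assumes "unitary_mat n M" "i < n" "j < n"
  shows "(\<Sum>q<n. M $$ (i, q) * cnj (M $$ (j, q))) = (if i = j then 1 else 0)"
proof -
  have M: "M \<in> carrier_mat n n" and eq: "M * mat_adjoint M = 1\<^sub>m n"
    using assms(1) by (auto simp: unitary_mat_def)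
  have "(M * mat_adjoint M) $$ (i, j) = (\<Sum>q<n. M $$ (i, q) * cnj (M $$ (j, q)))"
    unfolding index_mult_mat_sum[OF M mat_adjoint_carrier[OF M] assms(2,3)]
    by (intro sum.cong refl) (simp add: index_mat_adjoint[OF M _ assms(3)])
  with eq show ?thesis using assms(2,3) by simp
qed

text \<open>A matrix \<open>U\<close> with orthonormal columns is an isometry: expand the squared
  norm of \<open>U y\<close>, swap the sums and use \<open>U^* U = 1\<close>. The identity is
  computed over the complex numbers and then pulled back to the reals.\<close>

lemma orthonormal_parseval:
  fixes u :: "nat \<Rightarrow> nat \<Rightarrow> complex"
  assumes orth: "\<And>p q. p < m \<Longrightarrow> q < m \<Longrightarrow>
    (\<Sum>i<n. cnj (u i p) * u i q) = (if p = q then 1 else 0)"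
  shows "(\<Sum>i<n. (cmod (\<Sum>q<m. u i q * y q))\<^sup>2) = (\<Sum>q<m. (cmod (y q))\<^sup>2)"
proof -
  have "(\<Sum>i<n. (\<Sum>q<m. u i q * y q) * cnj (\<Sum>q<m. u i q * y q))
      = (\<Sum>i<n. \<Sum>q<m. \<Sum>p<m. cnj (u i p) * u i q * (y q * cnj (y p)))"
    by (simp add: sum_product algebra_simps)
  also have "\<dots> = (\<Sum>q<m. \<Sum>i<n. \<Sum>p<m. cnj (u i p) * u i q * (y q * cnj (y p)))"
    by (rule sum.swap)
  also have "\<dots> = (\<Sum>q<m. \<Sum>p<m. (\<Sum>i<n. cnj (u i p) * u i q) * (y q * cnj (y p)))"
    by (rule sum.cong[OF refl], rule trans[OF sum.swap], simp add: sum_distrib_right)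
  also have "\<dots> = (\<Sum>q<m. \<Sum>p<m. if p = q then y q * cnj (y p) else 0)"
    by (intro sum.cong refl) (simp add: orth)
  also have "\<dots> = (\<Sum>q<m. y q * cnj (y q))"
    by simp
  finally have "complex_of_real (\<Sum>i<n. (cmod (\<Sum>q<m. u i q * y q))\<^sup>2)
      = complex_of_real (\<Sum>q<m. (cmod (y q))\<^sup>2)"
    by (simp only: of_real_sum complex_norm_square)
  then show ?thesis by (simp only: of_real_eq_iff)
qed

text \<open>Pair the eigenvector equation of \<open>U^* I\<^sub>\<Lambda> U\<close> with
  \<open>y\<close>: \<mu> times the squared norm of \<open>y\<close> is the part of the squared norm
  of \<open>U y\<close> carried by \<Lambda>. This is at most the whole, which equals the squared
  norm of \<open>y\<close> by Parseval.\<close>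

lemma partial_gram_eigenvalue_le_1:
  fixes u :: "nat \<Rightarrow> nat \<Rightarrow> complex"
  assumes orth: "\<And>p q. p < m \<Longrightarrow> q < m \<Longrightarrow>
    (\<Sum>i<n. cnj (u i p) * u i q) = (if p = q then 1 else 0)"
    and \<Lambda>: "\<Lambda> \<subseteq> {..<n}"
    and ev: "\<And>p. p < m \<Longrightarrow>
      \<mu> * y p = (\<Sum>i\<in>\<Lambda>. (\<Sum>q<m. u i q * y q) * cnj (u i p))"
    and nz: "\<exists>p<m. y p \<noteq> 0"
  shows "cmod \<mu> \<le> 1"
proof -
  define N where "N = (\<Sum>p<m. (cmod (y p))\<^sup>2)"
  define w where "w i = (\<Sum>q<m. u i q * y q)" for i
  have N: "N > 0"
  proof -
    obtain p where "p < m" "y p \<noteq> 0" using nz by blast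
    then show ?thesis unfolding N_def by (intro sum_pos2[of _ p]) auto
  qed
  have "\<mu> * complex_of_real N = (\<Sum>p<m. (\<mu> * y p) * cnj (y p))"
    by (simp only: N_def of_real_sum complex_norm_square sum_distrib_left mult.assoc)
  also have "\<dots> = (\<Sum>p<m. \<Sum>i\<in>\<Lambda>. w i * (cnj (u i p) * cnj (y p)))"
    by (intro sum.cong refl) (simp add: ev w_def[symmetric] sum_distrib_right mult.assoc)
  also have "\<dots> = (\<Sum>i\<in>\<Lambda>. w i * cnj (w i))"
    by (subst sum.swap) (simp add: w_def sum_distrib_left)
  also have "\<dots> = complex_of_real (\<Sum>i\<in>\<Lambda>. (cmod (w i))\<^sup>2)"
    by (simp only: of_real_sum complex_norm_square)
  finally have "cmod (\<mu> * complex_of_real N) = cmod (complex_of_real (\<Sum>i\<in>\<Lambda>. (cmod (w i))\<^sup>2))"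
    by (rule arg_cong)
  then have "cmod \<mu> * N = (\<Sum>i\<in>\<Lambda>. (cmod (w i))\<^sup>2)"
    using N by (simp add: norm_mult sum_nonneg del: of_real_sum)
  also have "\<dots> \<le> (\<Sum>i<n. (cmod (w i))\<^sup>2)"
    using \<Lambda> by (intro sum_mono2) auto
  also have "\<dots> = N"
    unfolding w_def N_def by (rule orthonormal_parseval[OF orth])
  finally show ?thesis using N by simp
qed

section \<open>The kernel of the graph Laplacian\<close>

text \<open>Without multiple arcs, the arcs leaving a vertex are determined by their heads, so
  \<open>head G\<close> matches them with the labelled out-neighbours.\<close>

lemma out_degree_eq_sum:
  fixes v :: "nat \<Rightarrow> 'a"
  assumes "graph G" "bij_betw v {..<n} (verts G)"
  shows "of_nat (out_degree G (v i)) = (\<Sum>j<n. if v i \<rightarrow>\<^bsub>G\<^esub> v j then 1 else (0::complex))"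
proof -
  interpret graph G by fact
  have "bij_betw (head G) (out_arcs G (v i)) (v ` {j\<in>{..<n}. v i \<rightarrow>\<^bsub>G\<^esub> v j})"
    unfolding bij_betw_def
  proof
    show "inj_on (head G) (out_arcs G (v i))"
      by (rule inj_onI) (auto intro!: no_multi_arcs simp: arc_to_ends_def)
    show "head G ` out_arcs G (v i) = v ` {j\<in>{..<n}. v i \<rightarrow>\<^bsub>G\<^esub> v j}"
    proof (intro equalityI subsetI)
      fix x assume "x \<in> head G ` out_arcs G (v i)"
      then obtain e where e: "e \<in> arcs G" "tail G e = v i" "x = head G e" by auto
      then have "x \<in> v ` {..<n}" using assms(2) by (simp add: bij_betw_def)
      with e show "x \<in> v ` {j\<in>{..<n}. v i \<rightarrow>\<^bsub>G\<^esub> v j}"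
        by (force simp: arcs_ends_conv)
    next
      fix x assume "x \<in> v ` {j\<in>{..<n}. v i \<rightarrow>\<^bsub>G\<^esub> v j}"
      then show "x \<in> head G ` out_arcs G (v i)" by (force simp: arcs_ends_conv)
    qed
  qed
  then have "card (out_arcs G (v i)) = card (v ` {j\<in>{..<n}. v i \<rightarrow>\<^bsub>G\<^esub> v j})"
    by (rule bij_betw_same_card)
  also have "\<dots> = card {j\<in>{..<n}. v i \<rightarrow>\<^bsub>G\<^esub> v j}"
    using assms(2) by (intro card_image) (auto simp: bij_betw_def inj_on_def)
  finally have "complex_of_nat (out_degree G (v i)) = (\<Sum>j\<in>{j\<in>{..<n}. v i \<rightarrow>\<^bsub>G\<^esub> v j}. 1)"
    by (simp add: out_degree_def)
  also have "\<dots> = (\<Sum>j<n. if v i \<rightarrow>\<^bsub>G\<^esub> v j then 1 else 0)"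
    by (rule sum.inter_filter) simp
  finally show ?thesis .
qed

text \<open>Writing the degree as a row sum spreads the diagonal term over the neighbours, so the
  Laplacian acts as a difference operator.\<close>

lemma laplacian_apply:
  assumes "graph G" "bij_betw v {..<n} (verts G)" "i < n"
  shows "(\<Sum>j<n. laplacian G v n $$ (i, j) * x j)
    = (\<Sum>j<n. (if v i \<rightarrow>\<^bsub>G\<^esub> v j then 1 else 0) * (x i - x j))"
proof -
  have "(\<Sum>j<n. laplacian G v n $$ (i, j) * x j)
    = (\<Sum>j<n. (if j = i then of_nat (out_degree G (v i)) * x i else 0)
        - (if v i \<rightarrow>\<^bsub>G\<^esub> v j then 1 else 0) * x j)"
    using assms(3) by (intro sum.cong refl) (auto simp: laplacian_def mat_diag_def left_diff_distrib)
  also have "\<dots> = of_nat (out_degree G (v i)) * x i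
      - (\<Sum>j<n. (if v i \<rightarrow>\<^bsub>G\<^esub> v j then 1 else 0) * x j)"
    using assms(3) by (simp add: sum_subtractf)
  finally show ?thesis
    by (simp only: out_degree_eq_sum[OF assms(1,2)] sum_distrib_right right_diff_distrib sum_subtractf)
qed

text \<open>Energy argument: \<open>x^* L x\<close> is half the sum of \<open>|x i - x j|^2\<close>
  over ordered adjacent pairs, so it vanishes only if \<open>x\<close> agrees across every
  edge.\<close>

lemma laplacian_kernel_adjacent:
  assumes G: "graph G" and v: "bij_betw v {..<n} (verts G)"
    and ker: "\<And>i. i < n \<Longrightarrow> (\<Sum>j<n. laplacian G v n $$ (i, j) * x j) = 0"
    and ab: "a < n" "b < n" "v a \<rightarrow>\<^bsub>G\<^esub> v b"
  shows "x a = x b"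
proof -
  define A where "A i j = (if v i \<rightarrow>\<^bsub>G\<^esub> v j then 1 else (0::real))" for i j
  interpret graph G by fact
  have sym: "A i j = A j i" for i j
    using arcs_ends_symmetric[OF sym_arcs] by (auto simp: A_def)
  have 0: "(\<Sum>j<n. complex_of_real (A i j) * (x i - x j)) = 0" if "i < n" for i
    using ker[OF that] unfolding laplacian_apply[OF G v that] A_def
    by (simp add: if_distrib cong: if_cong)
  have 1: "(\<Sum>i<n. \<Sum>j<n. complex_of_real (A i j) * (x i - x j) * cnj (x i)) = 0"
    using 0 by (simp flip: sum_distrib_right)
  \<comment> \<open>The same quadratic form with the summation indices exchanged, using the symmetry
    of \<open>A\<close>. Adding it to fact \<open>1\<close> produces the squared
    differences.\<close>
  then have 2: "(\<Sum>i<n. \<Sum>j<n. complex_of_real (A i j) * (x j - x i) * cnj (x j)) = 0"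
    by (subst sum.swap) (simp add: sym)
  have "complex_of_real (\<Sum>i<n. \<Sum>j<n. A i j * (cmod (x i - x j))\<^sup>2)
    = (\<Sum>i<n. \<Sum>j<n. complex_of_real (A i j) * (x i - x j) * cnj (x i)
        + complex_of_real (A i j) * (x j - x i) * cnj (x j))"
    by (simp only: of_real_sum of_real_mult complex_norm_square)
       (intro sum.cong refl, simp add: algebra_simps)
  also have "\<dots> = 0" using 1 2 by (simp add: sum.distrib)
  finally have "(\<Sum>i<n. \<Sum>j<n. A i j * (cmod (x i - x j))\<^sup>2) = 0"
    by (simp only: of_real_eq_0_iff)
  moreover have nn: "A i j * (cmod (x i - x j))\<^sup>2 \<ge> 0" for i j by (simp add: A_def)
  ultimately have "(\<Sum>j<n. A a j * (cmod (x a - x j))\<^sup>2) = 0"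
    using ab(1) by (subst (asm) sum_nonneg_eq_0_iff) (auto intro!: sum_nonneg)
  then have "A a b * (cmod (x a - x b))\<^sup>2 = 0"
    using ab(2) nn by (subst (asm) sum_nonneg_eq_0_iff) auto
  then show ?thesis using ab(3) by (simp add: A_def)
qed

section \<open>The error operators of a canonical dual pair\<close>

lemma finsum_vec_index:
  assumes "finite F" "i < m" "\<And>x. x \<in> F \<Longrightarrow> f x \<in> carrier_vec m"
  shows "finsum_vec TYPE('a::comm_monoid_add) m f F $ i = (\<Sum>x\<in>F. f x $ i)"
proof -
  have "finsum_vec TYPE('a) m f F = finsum_vec TYPE('a) m (\<lambda>x. if x \<in> F then f x else 0\<^sub>v m) F"
    unfolding finsum_vec_def
    by (rule comm_monoid.finprod_cong'[OF comm_monoid_vec]) (auto simp: monoid_vec_simps assms)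
  also have "\<dots> $ i = (\<Sum>x\<in>F. f x $ i)"
    using assms by (subst index_finsum_vec) auto
  finally show ?thesis .
qed

lemma finsum_vec_carrier:
  assumes "\<And>x. x \<in> F \<Longrightarrow> f x \<in> carrier_vec m"
  shows "finsum_vec TYPE('a::comm_monoid_add) m f F \<in> carrier_vec m"
  using assms by (intro finsum_vec_closed) auto

lemma cscalar_prod_sum:
  assumes "x \<in> carrier_vec m" "y \<in> carrier_vec m"
  shows "x \<bullet>c y = (\<Sum>q<m. x $ q * cnj (y $ q))"
  using assms by (auto simp: scalar_prod_def lessThan_atLeast0 intro!: sum.cong)

text \<open>
  No sign condition on \<open>s\<close> is imposed: the square root of a negative real is negative in
  Isabelle, so positivity of the Laplacian eigenvalues need not be established.
\<close>

locale scaled_orthonormal =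
  fixes n m :: nat and u :: "nat \<Rightarrow> nat \<Rightarrow> complex" and s :: "nat \<Rightarrow> real"
    and \<Phi> :: "nat \<Rightarrow> complex vec"
  assumes orth: "\<And>p q. p < m \<Longrightarrow> q < m \<Longrightarrow>
      (\<Sum>i<n. cnj (u i p) * u i q) = (if p = q then 1 else 0)"
    and s_nz: "\<And>q. q < m \<Longrightarrow> s q \<noteq> 0"
    and \<Phi>: "\<And>i. i < n \<Longrightarrow> \<Phi> i = vec m (\<lambda>p. complex_of_real (s p) * cnj (u i p))"
begin

lemma cscalar_prod_\<Phi>:
  assumes "f \<in> carrier_vec m" "i < n"
  shows "f \<bullet>c \<Phi> i = (\<Sum>q<m. f $ q * (s q * u i q))"
proof -
  have "f \<bullet>c \<Phi> i = (\<Sum>q<m. f $ q * cnj (\<Phi> i $ q))"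
    using assms by (intro cscalar_prod_sum) (auto simp: \<Phi>)
  also have "\<dots> = (\<Sum>q<m. f $ q * (s q * u i q))"
    using assms by (intro sum.cong refl) (simp add: \<Phi>)
  finally show ?thesis .
qed

text \<open>Analysis followed by synthesis is \<open>diag(s) U^* U diag(s)\<close>, and
  \<open>orth\<close> collapses the middle factor.\<close>

lemma frame_op_eq:
  assumes "f \<in> carrier_vec m"
  shows "frame_op n m \<Phi> f = vec m (\<lambda>p. (complex_of_real (s p))\<^sup>2 * f $ p)"
proof (rule eq_vecI)
  have car: "(f \<bullet>c \<Phi> i) \<cdot>\<^sub>v \<Phi> i \<in> carrier_vec m" if "i \<in> {..<n}" for i
    using that by (auto simp: \<Phi>)
  show "dim_vec (frame_op n m \<Phi> f) = dim_vec (vec m (\<lambda>p. (complex_of_real (s p))\<^sup>2 * f $ p))"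
    using finsum_vec_carrier[of "{..<n}" "\<lambda>i. (f \<bullet>c \<Phi> i) \<cdot>\<^sub>v \<Phi> i" m, OF car]
    by (simp add: frame_op_def)
  fix p assume "p < dim_vec (vec m (\<lambda>p. (complex_of_real (s p))\<^sup>2 * f $ p))"
  then have p: "p < m" by simp
  have "frame_op n m \<Phi> f $ p = (\<Sum>i<n. ((f \<bullet>c \<Phi> i) \<cdot>\<^sub>v \<Phi> i) $ p)"
    unfolding frame_op_def by (rule finsum_vec_index[OF finite_lessThan p car])
  also have "\<dots> = (\<Sum>i<n. (\<Sum>q<m. f $ q * (s q * u i q)) * (s p * cnj (u i p)))"
    using p by (intro sum.cong refl) (simp add: cscalar_prod_\<Phi>[OF assms], simp add: \<Phi>)
  also have "\<dots> = (\<Sum>i<n. \<Sum>q<m. (f $ q * s q * s p) * (cnj (u i p) * u i q))"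
    by (simp only: sum_distrib_right) (intro sum.cong refl, simp add: mult_ac)
  also have "\<dots> = (\<Sum>q<m. (f $ q * s q * s p) * (\<Sum>i<n. cnj (u i p) * u i q))"
    by (subst sum.swap) (simp add: sum_distrib_left)
  also have "\<dots> = (\<Sum>q<m. if p = q then f $ q * s q * s p else 0)"
    using p by (intro sum.cong refl) (auto simp: orth)
  also have "\<dots> = (complex_of_real (s p))\<^sup>2 * f $ p"
    using p by (simp add: power2_eq_square)
  finally show "frame_op n m \<Phi> f $ p = vec m (\<lambda>p. (complex_of_real (s p))\<^sup>2 * f $ p) $ p"
    using p by simp
qed

text \<open>\<open>inv_into\<close> chooses some preimage; injectivity of the frame operator, due to
  \<open>s_nz\<close>, pins it down. The value is \<open>diag(s)^-2\<close> applied to a column of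
  \<open>diag(s) U^*\<close>.\<close>

lemma canonical_dual_eq:
  assumes "i < n"
  shows "canonical_dual n m \<Phi> i = vec m (\<lambda>p. cnj (u i p) / complex_of_real (s p))"
    (is "_ = ?g")
proof -
  have "inj_on (frame_op n m \<Phi>) (carrier_vec m)"
  proof (rule inj_onI)
    fix f g assume f: "f \<in> carrier_vec m" and g: "g \<in> carrier_vec m"
      and eq: "frame_op n m \<Phi> f = frame_op n m \<Phi> g"
    show "f = g"
    proof (rule eq_vecI)
      fix p assume "p < dim_vec g"
      then have p: "p < m" using g by simp
      have "frame_op n m \<Phi> f $ p = frame_op n m \<Phi> g $ p" by (simp only: eq)
      then show "f $ p = g $ p" using p f g s_nz[OF p] by (simp add: frame_op_eq)
    qed (use f g in auto)
  qed
  moreover have "frame_op n m \<Phi> ?g = \<Phi> i"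
    using assms s_nz by (auto simp: frame_op_eq \<Phi> power2_eq_square)
  ultimately show ?thesis
    unfolding canonical_dual_def by (rule inv_into_f_eq[OF _ vec_carrier])
qed

abbreviation "E \<Lambda> \<equiv> op_mat m (error_op m \<Phi> (canonical_dual n m \<Phi>) \<Lambda>)"

lemma E_carrier: "E \<Lambda> \<in> carrier_mat m m"
  by (simp add: op_mat_def)

text \<open>These are the entries of \<open>diag(s)^-1 U^* I\<^sub>\<Lambda> U diag(s)\<close>: the
  frame contributes the right factor \<open>diag(s)\<close>, the dual the left factor
  \<open>diag(s)^-1\<close>.\<close>

lemma E_index:
  assumes \<Lambda>: "\<Lambda> \<subseteq> {..<n}" and p: "p < m" and q: "q < m"
  shows "E \<Lambda> $$ (p, q) = (\<Sum>i\<in>\<Lambda>. s q * u i q * cnj (u i p) / s p)"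
proof -
  have fin: "finite \<Lambda>" using \<Lambda> finite_subset by blast
  have car: "(f \<bullet>c \<Phi> i) \<cdot>\<^sub>v canonical_dual n m \<Phi> i \<in> carrier_vec m" if "i \<in> \<Lambda>" for i f
    using that \<Lambda> by (auto simp: canonical_dual_eq)
  have unit: "unit_vec m q \<bullet>c \<Phi> i = s q * u i q" if "i \<in> \<Lambda>" for i
  proof -
    have "unit_vec m q \<bullet>c \<Phi> i = (\<Sum>j<m. unit_vec m q $ j * (s j * u i j))"
      using that \<Lambda> by (intro cscalar_prod_\<Phi>) auto
    also have "\<dots> = (\<Sum>j<m. if j = q then s j * u i j else 0)"
      using q by (intro sum.cong refl) (auto simp: index_unit_vec)
    finally show ?thesis using q by simp
  qed
  have "E \<Lambda> $$ (p, q)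
      = (\<Sum>i\<in>\<Lambda>. ((unit_vec m q \<bullet>c \<Phi> i) \<cdot>\<^sub>v canonical_dual n m \<Phi> i) $ p)"
    using p q finsum_vec_index[OF fin p car] by (simp add: op_mat_def error_op_def)
  also have "\<dots> = (\<Sum>i\<in>\<Lambda>. s q * u i q * cnj (u i p) / s p)"
  proof (rule sum.cong[OF refl])
    fix i assume i: "i \<in> \<Lambda>"
    then have "i < n" using \<Lambda> by auto
    then show "((unit_vec m q \<bullet>c \<Phi> i) \<cdot>\<^sub>v canonical_dual n m \<Phi> i) $ p
        = s q * u i q * cnj (u i p) / s p"
      using p by (simp add: unit[OF i] canonical_dual_eq)
  qed
  finally show ?thesis .
qed

text \<open>The similarity in division-free form: with \<open>y = diag(s) x\<close>, the operator
  \<open>E \<Lambda>\<close> on \<open>x\<close> becomes \<open>U^* I\<^sub>\<Lambda> U\<close> on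
  \<open>y\<close>. Both eigenvalue lemmas below rest on it.\<close>

lemma E_mult_vec:
  assumes "\<Lambda> \<subseteq> {..<n}" "x \<in> carrier_vec m" "p < m"
  shows "s p * (E \<Lambda> *\<^sub>v x) $ p
    = (\<Sum>i\<in>\<Lambda>. (\<Sum>q<m. u i q * (s q * x $ q)) * cnj (u i p))"
proof -
  have "(E \<Lambda> *\<^sub>v x) $ p = (\<Sum>q<m. E \<Lambda> $$ (p, q) * x $ q)"
    by (rule index_mult_mat_vec_sum[OF E_carrier assms(2,3)])
  also have "\<dots> = (\<Sum>q<m. \<Sum>i\<in>\<Lambda>. s q * u i q * cnj (u i p) / s p * x $ q)"
    using assms by (intro sum.cong refl) (simp add: E_index sum_distrib_right)
  also have "\<dots> = (\<Sum>i\<in>\<Lambda>. \<Sum>q<m. s q * u i q * cnj (u i p) / s p * x $ q)"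
    by (rule sum.swap)
  finally have eq: "(E \<Lambda> *\<^sub>v x) $ p
      = (\<Sum>i\<in>\<Lambda>. \<Sum>q<m. s q * u i q * cnj (u i p) / s p * x $ q)" .
  show ?thesis
    unfolding eq sum_distrib_left sum_distrib_right using s_nz[OF assms(3)]
    by (intro sum.cong refl) (simp add: field_simps)
qed

lemma eigenvalue_E_le_1:
  assumes \<Lambda>: "\<Lambda> \<subseteq> {..<n}" and ev: "eigenvalue (E \<Lambda>) \<mu>"
  shows "cmod \<mu> \<le> 1"
proof -
  obtain x where x: "x \<in> carrier_vec m" "x \<noteq> 0\<^sub>v m" "E \<Lambda> *\<^sub>v x = \<mu> \<cdot>\<^sub>v x"
    using ev E_carrier[of \<Lambda>] by (auto simp: eigenvalue_def eigenvector_def)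
  have "\<exists>p<m. x $ p \<noteq> 0" using x(1,2) by (metis carrier_vecD eq_vecI index_zero_vec)
  then have nz: "\<exists>p<m. complex_of_real (s p) * x $ p \<noteq> 0" using s_nz by auto
  show ?thesis
  proof (rule partial_gram_eigenvalue_le_1[OF orth \<Lambda> _ nz])
    fix p assume p: "p < m"
    show "\<mu> * (s p * x $ p) = (\<Sum>i\<in>\<Lambda>. (\<Sum>q<m. u i q * (s q * x $ q)) * cnj (u i p))"
      using E_mult_vec[OF \<Lambda> x(1) p] p x(1) by (simp add: x(3) mult_ac)
  qed
qed

lemma eigenvalue_E_1:
  assumes \<Lambda>: "\<Lambda> \<subseteq> {..<n}"
    and supp: "\<And>i. i < n \<Longrightarrow> i \<notin> \<Lambda> \<Longrightarrow> (\<Sum>q<m. u i q * y q) = 0"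
    and nz: "\<exists>p<m. y p \<noteq> 0"
  shows "eigenvalue (E \<Lambda>) 1"
proof -
  \<comment> \<open>Undoes the scaling, so that an eigenvector \<open>y\<close> of
    \<open>U^* I\<^sub>\<Lambda> U\<close> becomes one of \<open>E \<Lambda>\<close>.\<close>
  define x where "x = vec m (\<lambda>p. y p / s p)"
  have x: "x \<in> carrier_vec m" by (simp add: x_def)
  have sx: "s p * x $ p = y p" if "p < m" for p using that s_nz by (simp add: x_def)
  have "x \<noteq> 0\<^sub>v m"
  proof
    assume "x = 0\<^sub>v m"
    then have "y p = 0" if "p < m" for p using sx[OF that] that by simp
    with nz show False by blast
  qed
  moreover have "E \<Lambda> *\<^sub>v x = 1 \<cdot>\<^sub>v x"
  proof (rule eq_vecI)
    fix p assume "p < dim_vec (1 \<cdot>\<^sub>v x)"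
    then have p: "p < m" using x by simp
    have "s p * (E \<Lambda> *\<^sub>v x) $ p = (\<Sum>i\<in>\<Lambda>. (\<Sum>q<m. u i q * y q) * cnj (u i p))"
      unfolding E_mult_vec[OF \<Lambda> x p] by (simp add: sx)
    also have "\<dots> = (\<Sum>i<n. (\<Sum>q<m. u i q * y q) * cnj (u i p))"
      using \<Lambda> supp by (intro sum.mono_neutral_left) auto
    also have "\<dots> = (\<Sum>i<n. \<Sum>q<m. y q * (cnj (u i p) * u i q))"
      by (simp only: sum_distrib_right) (intro sum.cong refl, simp add: mult_ac)
    also have "\<dots> = (\<Sum>q<m. y q * (\<Sum>i<n. cnj (u i p) * u i q))"
      by (subst sum.swap) (simp add: sum_distrib_left)
    also have "\<dots> = (\<Sum>q<m. if p = q then y q else 0)"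
      using p by (intro sum.cong refl) (auto simp: orth)
    also have "\<dots> = s p * x $ p" using p sx by simp
    finally show "(E \<Lambda> *\<^sub>v x) $ p = (1 \<cdot>\<^sub>v x) $ p"
      using s_nz[OF p] p x by simp
  qed (use x E_carrier[of \<Lambda>] in auto)
  ultimately have "eigenvector (E \<Lambda>) x 1"
    using x E_carrier[of \<Lambda>] by (simp add: eigenvector_def)
  then show ?thesis unfolding eigenvalue_def by blast
qed

lemma max_error_radius_eq_1:
  assumes m: "m > 0" and \<Lambda>0: "\<Lambda>0 \<subseteq> {..<n}" "card \<Lambda>0 = r"
    and supp: "\<And>i. i < n \<Longrightarrow> i \<notin> \<Lambda>0 \<Longrightarrow> (\<Sum>q<m. u i q * y q) = 0"
    and nz: "\<exists>p<m. y p \<noteq> 0"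
  shows "max_error_radius n m r \<Phi> (canonical_dual n m \<Phi>) = 1"
proof -
  let ?R = "{spectral_radius (E \<Lambda>) |\<Lambda>. \<Lambda> \<subseteq> {..<n} \<and> card \<Lambda> = r}"
  \<comment> \<open>Since \<open>m > 0\<close>, the spectrum is nonempty and the spectral radius is
    the modulus of an actual eigenvalue.\<close>
  have le: "spectral_radius (E \<Lambda>) \<le> 1" if "\<Lambda> \<subseteq> {..<n}" for \<Lambda>
    using spectral_radius_mem_max(1)[OF E_carrier[of \<Lambda>] m] eigenvalue_E_le_1[OF that]
    by (auto simp: spectrum_def)
  have "1 \<in> norm ` spectrum (E \<Lambda>0)"
    using eigenvalue_E_1[OF \<Lambda>0(1) supp nz] by (force simp: spectrum_def)
  then have "spectral_radius (E \<Lambda>0) = 1"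
    by (intro antisym le[OF \<Lambda>0(1)] spectral_radius_mem_max(2)[OF E_carrier m])
  then have "1 \<in> ?R" using \<Lambda>0 by force
  moreover have "finite ?R"
    by (rule finite_subset[of _ "(\<lambda>\<Lambda>. spectral_radius (E \<Lambda>)) ` Pow {..<n}"]) auto
  ultimately show ?thesis
    unfolding max_error_radius_def using le by (intro Max_eqI) auto
qed

end

section \<open>Graph frames and the spectral decomposition of the Laplacian\<close>

lemma LG_mat_col:
  assumes M: "M \<in> carrier_mat n n" and i: "i < n"
  shows "LG_mat n m M l *\<^sub>v unit_vec n i
    = vec m (\<lambda>p. complex_of_real (sqrt (l p)) * cnj (M $$ (i, p)))"
proof -
  let ?U = "mat n m (\<lambda>(i, j). M $$ (i, j))"
  have U: "?U \<in> carrier_mat n m" by simp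
  have *: "LG_mat n m M l
      = mat m n (\<lambda>(p, j). complex_of_real (sqrt (l p)) * mat_adjoint ?U $$ (p, j))"
    unfolding LG_mat_def by (rule mat_diag_mult_left[OF mat_adjoint_carrier[OF U]])
  show ?thesis
  proof (rule eq_vecI)
    fix p assume "p < dim_vec (vec m (\<lambda>p. complex_of_real (sqrt (l p)) * cnj (M $$ (i, p))))"
    then have p: "p < m" by simp
    have "mat_adjoint ?U $$ (p, i) = cnj (M $$ (i, p))"
      unfolding index_mat_adjoint[OF U p i] using p i by simp
    then show "(LG_mat n m M l *\<^sub>v unit_vec n i) $ p
        = vec m (\<lambda>p. complex_of_real (sqrt (l p)) * cnj (M $$ (i, p))) $ p"
      unfolding * using p i by simp
  qed (simp add: *)
qed

text \<open>Right multiplication by \<open>M\<close> cancels the adjoint, giving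
  \<open>L M = M diag(d)\<close>: the columns of \<open>M\<close> are eigenvectors. Those with
  \<open>d q = 0\<close> will supply kernel vectors of the Laplacian.\<close>

lemma spectral_decomposition_columns:
  assumes M: "unitary_mat n M" and L: "L = M * mat_diag n d * mat_adjoint M"
    and "i < n" "q < n"
  shows "(\<Sum>j<n. L $$ (i, j) * M $$ (j, q)) = M $$ (i, q) * d q"
proof -
  have Mc: "M \<in> carrier_mat n n" and eq: "mat_adjoint M * M = 1\<^sub>m n"
    using M by (auto simp: unitary_mat_def)
  note Mc' = mat_adjoint_carrier[OF Mc]
  have D: "mat_diag n d \<in> carrier_mat n n" by simp
  have Lc: "L \<in> carrier_mat n n" unfolding L using Mc Mc' D by auto
  have "L * M = M * mat_diag n d * (mat_adjoint M * M)"
    unfolding L by (rule assoc_mult_mat[OF mult_carrier_mat[OF Mc D] Mc' Mc])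
  then have LM: "L * M = M * mat_diag n d"
    by (simp only: eq right_mult_one_mat[OF mult_carrier_mat[OF Mc D]])
  have "(\<Sum>j<n. L $$ (i, j) * M $$ (j, q)) = (L * M) $$ (i, q)"
    by (rule index_mult_mat_sum[OF Lc Mc assms(3,4), symmetric])
  also have "\<dots> = M $$ (i, q) * d q"
    unfolding LM mat_diag_mult_right[OF Mc] using assms(3,4) by simp
  finally show ?thesis .
qed

theorem theorem3p4:
  fixes G :: "('a, 'b) pre_digraph" and v :: "nat \<Rightarrow> 'a"
    and n k r :: nat and \<Phi> :: "nat \<Rightarrow> complex vec"
  assumes "graph G" and "bij_betw v {..<n} (verts G)"
    and "card (pre_digraph.sccs G) = k" and "k > 1"
    and "n - k > 0"
    and "LG_frame G v n (n - k) \<Phi>"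
    and "r \<in> {1..n - 1} - {1}"
  shows "max_error_radius n (n - k) r \<Phi> (canonical_dual n (n - k) \<Phi>) = 1"
proof -
  define m where "m = n - k"
  have m: "m > 0" "m \<le> n" using assms(5) by (auto simp: m_def)
  obtain M l where M: "unitary_mat n M" and l: "\<forall>i<m. l i \<noteq> 0"
    and L: "laplacian G v n =
      M * mat_diag n (\<lambda>i. if i < m then complex_of_real (l i) else 0) * mat_adjoint M"
    and \<Phi>: "\<forall>i<n. \<Phi> i = LG_mat n m M l *\<^sub>v unit_vec n i"
    using assms(6) unfolding LG_frame_def m_def by blast
  have Mc: "M \<in> carrier_mat n n" using M by (simp add: unitary_mat_def)
  note cols = spectral_decomposition_columns[OF M L]
  interpret scaled_orthonormal n m "\<lambda>i q. M $$ (i, q)" "\<lambda>q. sqrt (l q)" \<Phi>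
  proof
    show "(\<Sum>i<n. cnj (M $$ (i, p)) * M $$ (i, q)) = (if p = q then 1 else 0)"
      if "p < m" "q < m" for p q
      using that m unitary_mat_cols[OF M] by simp
  qed (use l \<Phi> LG_mat_col[OF Mc] in auto)
  \<comment> \<open>Without edges the Laplacian would be zero, yet column \<open>0\<close> of
    \<open>M\<close> is a unit eigenvector with eigenvalue \<open>l 0\<close>, nonzero because
    \<open>m > 0\<close>.\<close>
  have "\<exists>a<n. \<exists>b<n. v a \<rightarrow>\<^bsub>G\<^esub> v b"
  proof (rule ccontr)
    assume no_edge: "\<not> ?thesis"
    have "M $$ (i, 0) = 0" if "i < n" for i
    proof -
      have "M $$ (i, 0) * complex_of_real (l 0) = (\<Sum>j<n. laplacian G v n $$ (i, j) * M $$ (j, 0))"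
        using cols[OF that, of 0] m by simp
      also have "\<dots> = 0"
        unfolding laplacian_apply[OF assms(1,2) that] using no_edge that
        by (intro sum.neutral) auto
      finally show ?thesis using l m by simp
    qed
    then have "(\<Sum>i<n. cnj (M $$ (i, 0)) * M $$ (i, 0)) = 0" by simp
    then show False using unitary_mat_cols[OF M, of 0 0] m by simp
  qed
  then obtain a b where ab: "a < n" "b < n" "v a \<rightarrow>\<^bsub>G\<^esub> v b" by blast
  have "a \<noteq> b"
    using ab(3) loopfree_digraph.adj_not_same assms(1)
    by (metis digraph.axioms(2) graph_def)
  \<comment> \<open>Here \<open>r \<ge> 2\<close> enters: the erased set must have room for both
    ends of the edge.\<close>
  then have "card {a, b} \<le> r" using assms(7) by auto
  moreover have "r \<le> card {..<n}" using assms(7) by auto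
  ultimately obtain \<Lambda> where \<Lambda>: "{a, b} \<subseteq> \<Lambda>" "\<Lambda> \<subseteq> {..<n}" "card \<Lambda> = r"
    using exists_subset_between[of "{a, b}" r "{..<n}"] ab by auto
  \<comment> \<open>The coordinates of \<open>e\<^sub>a - e\<^sub>b\<close> in the orthonormal basis
    formed by the columns of \<open>M\<close>.\<close>
  define y where "y q = cnj (M $$ (a, q)) - cnj (M $$ (b, q))" for q
  \<comment> \<open>Columns from \<open>m\<close> on lie in the kernel of the Laplacian, hence agree
    at \<open>a\<close> and \<open>b\<close>. So the first \<open>m\<close> columns already
    reproduce \<open>e\<^sub>a - e\<^sub>b\<close>, by row orthonormality.\<close>
  have "y q = 0" if "m \<le> q" "q < n" for q
  proof -
    have "M $$ (a, q) = M $$ (b, q)"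
      by (rule laplacian_kernel_adjacent[OF assms(1,2) _ ab, of "\<lambda>i. M $$ (i, q)"])
         (use that cols in auto)
    then show ?thesis by (simp add: y_def)
  qed
  then have "(\<Sum>q<m. M $$ (i, q) * y q) = (\<Sum>q<n. M $$ (i, q) * y q)" for i
    using m(2) by (intro sum.mono_neutral_left) auto
  then have My: "(\<Sum>q<m. M $$ (i, q) * y q) = (if i = a then 1 else 0) - (if i = b then 1 else 0)"
    if "i < n" for i
    using that ab unitary_mat_rows[OF M] by (simp add: y_def right_diff_distrib sum_subtractf)
  have "\<exists>p<m. y p \<noteq> 0"
  proof (rule ccontr)
    assume "\<not> ?thesis"
    then have "(\<Sum>q<m. M $$ (a, q) * y q) = 0" by simp
    with My[OF ab(1)] \<open>a \<noteq> b\<close> show False by simp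
  qed
  moreover have "(\<Sum>q<m. M $$ (i, q) * y q) = 0" if "i < n" "i \<notin> \<Lambda>" for i
    using My[OF that(1)] that(2) \<Lambda>(1) by auto
  ultimately show ?thesis
    using max_error_radius_eq_1[OF m(1) \<Lambda>(2,3)] unfolding m_def by blast
qed

end
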